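(* Let $k$ be a constant and let $\varphi:(M^2,g=dr^2+\sigma^2(r)d\theta^2)\longrightarrow(N^2,h=d\rho^2+\lambda^2(\rho)d\phi^2)$, $\varphi(r,\theta)=(\rho(r),k\theta)$, be a proper biharmonic map with $\tau(\varphi)\neq0$ (nowhere zero). Let $C_1,C_2$ be constants with $C_1^2+C_2^2\neq0$ and let $$f=C_1+C_2\int\Big(\rho''+\frac{\sigma'}{\sigma}\rho'-\frac{k^2\lambda(\rho)\lambda'(\rho)}{\sigma^2}\Big)^{-2}\sigma^{-1}\,dr ,$$ where $\int\cdots dr$ denotes an antiderivative, and assume $f>0$. Then the rotationally symmetric map $\varphi:(M^2,f^{-1}g)\longrightarrow(N^2,h)$ is a proper biharmonic map.
   Context: For a smooth map $\phi:(M,g)\to(N,h)$ of Riemannian manifolds, $\tau(\phi)=\mathrm{Tr}_g\nabla d\phi$ is the tension field and $\tau_2(\phi)=\mathrm{Trace}_g(\nabla^\phi\nabla^\phi-\nabla^\phi_{\nabla^M})\tau(\phi)-\mathrm{Trace}_g R^N(d\phi,\tau(\phi))d\phi$ is the bitension field, with $R^N(X,Y)Z=[\nabla^N_X,\nabla^N_Y]Z-\nabla^N_{[X,Y]}Z$. The map is harmonic if $\tau(\phi)=0$, biharmonic if $\tau_2(\phi)=0$, and proper biharmonic if it is biharmonic but not harmonic. Here $(r,\theta)$ and $(\rho,\phi)$ are polar-type coordinates on $M^2$, $N^2$ ($\theta,\phi$ angular), $r$ ranging over an interval; $\sigma$ and $\lambda$ are positive smooth functions of one variable; primes on $\rho,\sigma$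 are $d/dr$ and $\lambda'=d\lambda/d\rho$, evaluated at $\rho=\rho(r)$. When $k$ is not an integer the statement is understood in local coordinates (locally in $\theta$). *)

theory Defs
  imports "HOL-Analysis.Analysis"
begin

text \<open>
  Riemannian geometry in coordinates: a manifold is represented by an open set of
  \<open>real ^ 'm\<close> (the range of a chart), a metric by its Gram matrix as a function of the point,
  and vector fields, also along a map, by their coordinate expressions. Every differential operator
  below depends only on the germs of its arguments at the point of evaluation.
\<close>

section \<open>Smoothness\<close>

fun iter_partial :: "'a::real_normed_vector list \<Rightarrow> ('a \<Rightarrow> 'b::real_normed_vector) \<Rightarrow> 'a \<Rightarrow> 'b"
where
  "iter_partial [] F = F"
| "iter_partial (b # bs) F = (\<lambda>x. frechet_derivative (iter_partial bs F) (at x) b)"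

text \<open>Class \<open>C\<^sup>\<infinity>\<close>; meant for open \<open>S\<close> only.\<close>

definition smooth_on :: "'a::euclidean_space set \<Rightarrow> ('a \<Rightarrow> 'b::real_normed_vector) \<Rightarrow> bool" where
  "smooth_on S F \<longleftrightarrow> (\<forall>bs. set bs \<subseteq> Basis \<longrightarrow> (\<forall>x\<in>S. iter_partial bs F differentiable (at x)))"

section \<open>Metrics, Levi-Civita connection, curvature\<close>

type_synonym 'n metric = "real ^ 'n \<Rightarrow> real ^ 'n ^ 'n"

type_synonym 'n vfield = "real ^ 'n \<Rightarrow> real ^ 'n"

definition riemannian_metric_on :: "(real ^ 'n) set \<Rightarrow> 'n::finite metric \<Rightarrow> bool" where
  "riemannian_metric_on U g \<longleftrightarrow> smooth_on U g \<and>
     (\<forall>x\<in>U. transpose (g x) = g x \<and> (\<forall>v. v \<noteq> 0 \<longrightarrow> v \<bullet> (g x *v v) > 0))"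

definition partial :: "'n::finite \<Rightarrow> (real ^ 'n \<Rightarrow> 'b::real_normed_vector) \<Rightarrow> real ^ 'n \<Rightarrow> 'b" where
  "partial i F x = frechet_derivative F (at x) (axis i 1)"

text \<open>\<open>christoffel g k i j x\<close> is the symbol with upper index \<open>k\<close> and lower indices \<open>i\<close>, \<open>j\<close>.\<close>

definition christoffel :: "'n::finite metric \<Rightarrow> 'n \<Rightarrow> 'n \<Rightarrow> 'n \<Rightarrow> real ^ 'n \<Rightarrow> real" where
  "christoffel g k i j x = (1/2) * (\<Sum>l\<in>UNIV. matrix_inv (g x) $ k $ l *
     (partial i (\<lambda>y. g y $ j $ l) x + partial j (\<lambda>y. g y $ i $ l) x - partial l (\<lambda>y. g y $ i $ j) x))"

definition christoffel_form :: "'n::finite metric \<Rightarrow> real ^ 'n \<Rightarrow> real ^ 'n \<Rightarrow> real ^ 'n \<Rightarrow> real ^ 'n" where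
  "christoffel_form g x u v = (\<chi> k. \<Sum>i\<in>UNIV. \<Sum>j\<in>UNIV. christoffel g k i j x * u $ i * v $ j)"

definition cov_deriv :: "'n::finite metric \<Rightarrow> 'n vfield \<Rightarrow> 'n vfield \<Rightarrow> 'n vfield" where
  "cov_deriv g X Y x = frechet_derivative Y (at x) (X x) + christoffel_form g x (X x) (Y x)"

definition lie_bracket :: "'n::finite vfield \<Rightarrow> 'n vfield \<Rightarrow> 'n vfield" where
  "lie_bracket X Y x = frechet_derivative Y (at x) (X x) - frechet_derivative X (at x) (Y x)"

definition riemann :: "'n::finite metric \<Rightarrow> 'n vfield \<Rightarrow> 'n vfield \<Rightarrow> 'n vfield \<Rightarrow> 'n vfield" where
  "riemann h X Y Z y = cov_deriv h X (cov_deriv h Y Z) y - cov_deriv h Y (cov_deriv h X Z) y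
     - cov_deriv h (lie_bracket X Y) Z y"

text \<open>The curvature is tensorial, so its value on tangent vectors at \<open>y\<close> may be computed
  with any extensions to vector fields; the ones with constant coordinates are taken.\<close>

definition riemann_at :: "'n::finite metric \<Rightarrow> real ^ 'n \<Rightarrow> real ^ 'n \<Rightarrow> real ^ 'n \<Rightarrow> real ^ 'n \<Rightarrow> real ^ 'n" where
  "riemann_at h y u v w = riemann h (\<lambda>_. u) (\<lambda>_. v) (\<lambda>_. w) y"

definition frame :: "'n::finite \<Rightarrow> 'n vfield" where
  "frame i = (\<lambda>_. axis i 1)"

text \<open>Trace of a bilinear form given by its values on pairs of coordinate vector fields.\<close>

definition metric_trace :: "'m::finite metric \<Rightarrow> real ^ 'm \<Rightarrow> ('m \<Rightarrow> 'm \<Rightarrow> real ^ 'n) \<Rightarrow> real ^ 'n" where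
  "metric_trace g x B = (\<Sum>i\<in>UNIV. \<Sum>j\<in>UNIV. (matrix_inv (g x) $ i $ j) *\<^sub>R B i j)"

section \<open>Tension and bitension fields\<close>

definition push :: "(real ^ 'm::finite \<Rightarrow> real ^ 'n::finite) \<Rightarrow> 'm vfield \<Rightarrow> real ^ 'm \<Rightarrow> real ^ 'n" where
  "push \<phi> X x = frechet_derivative \<phi> (at x) (X x)"

text \<open>The connection of the pull-back bundle; \<open>V\<close> is a vector field along \<open>\<phi>\<close>.\<close>

definition pullback_cov :: "'n::finite metric \<Rightarrow> (real ^ 'm::finite \<Rightarrow> real ^ 'n) \<Rightarrow> 'm vfield \<Rightarrow>
    (real ^ 'm \<Rightarrow> real ^ 'n) \<Rightarrow> real ^ 'm \<Rightarrow> real ^ 'n" where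
  "pullback_cov h \<phi> X V x =
     frechet_derivative V (at x) (X x) + christoffel_form h (\<phi> x) (push \<phi> X x) (V x)"

definition second_fundamental_form :: "'m::finite metric \<Rightarrow> 'n::finite metric \<Rightarrow>
    (real ^ 'm \<Rightarrow> real ^ 'n) \<Rightarrow> 'm vfield \<Rightarrow> 'm vfield \<Rightarrow> real ^ 'm \<Rightarrow> real ^ 'n" where
  "second_fundamental_form g h \<phi> X Y x =
     pullback_cov h \<phi> X (push \<phi> Y) x - push \<phi> (cov_deriv g X Y) x"

definition tension :: "'m::finite metric \<Rightarrow> 'n::finite metric \<Rightarrow>
    (real ^ 'm \<Rightarrow> real ^ 'n) \<Rightarrow> real ^ 'm \<Rightarrow> real ^ 'n" where
  "tension g h \<phi> x =
     metric_trace g x (\<lambda>i j. second_fundamental_form g h \<phi> (frame i) (frame j) x)"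

definition rough_laplacian :: "'m::finite metric \<Rightarrow> 'n::finite metric \<Rightarrow>
    (real ^ 'm \<Rightarrow> real ^ 'n) \<Rightarrow> (real ^ 'm \<Rightarrow> real ^ 'n) \<Rightarrow> real ^ 'm \<Rightarrow> real ^ 'n" where
  "rough_laplacian g h \<phi> V x = metric_trace g x (\<lambda>i j.
     pullback_cov h \<phi> (frame i) (pullback_cov h \<phi> (frame j) V) x
     - pullback_cov h \<phi> (cov_deriv g (frame i) (frame j)) V x)"

definition bitension :: "'m::finite metric \<Rightarrow> 'n::finite metric \<Rightarrow>
    (real ^ 'm \<Rightarrow> real ^ 'n) \<Rightarrow> real ^ 'm \<Rightarrow> real ^ 'n" where
  "bitension g h \<phi> x = rough_laplacian g h \<phi> (tension g h \<phi>) x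
     - metric_trace g x (\<lambda>i j. riemann_at h (\<phi> x)
         (push \<phi> (frame i) x) (tension g h \<phi> x) (push \<phi> (frame j) x))"

definition smooth_riemannian_map :: "(real ^ 'm::finite) set \<Rightarrow> 'm metric \<Rightarrow>
    (real ^ 'n::finite) set \<Rightarrow> 'n metric \<Rightarrow> (real ^ 'm \<Rightarrow> real ^ 'n) \<Rightarrow> bool" where
  "smooth_riemannian_map U g V h \<phi> \<longleftrightarrow> open U \<and> open V \<and>
     riemannian_metric_on U g \<and> riemannian_metric_on V h \<and> \<phi> ` U \<subseteq> V \<and> smooth_on U \<phi>"

definition harmonic_map :: "(real ^ 'm::finite) set \<Rightarrow> 'm metric \<Rightarrow>
    (real ^ 'n::finite) set \<Rightarrow> 'n metric \<Rightarrow> (real ^ 'm \<Rightarrow> real ^ 'n) \<Rightarrow> bool" where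
  "harmonic_map U g V h \<phi> \<longleftrightarrow>
     smooth_riemannian_map U g V h \<phi> \<and> (\<forall>x\<in>U. tension g h \<phi> x = 0)"

definition biharmonic_map :: "(real ^ 'm::finite) set \<Rightarrow> 'm metric \<Rightarrow>
    (real ^ 'n::finite) set \<Rightarrow> 'n metric \<Rightarrow> (real ^ 'm \<Rightarrow> real ^ 'n) \<Rightarrow> bool" where
  "biharmonic_map U g V h \<phi> \<longleftrightarrow>
     smooth_riemannian_map U g V h \<phi> \<and> (\<forall>x\<in>U. bitension g h \<phi> x = 0)"

definition proper_biharmonic_map :: "(real ^ 'm::finite) set \<Rightarrow> 'm metric \<Rightarrow>
    (real ^ 'n::finite) set \<Rightarrow> 'n metric \<Rightarrow> (real ^ 'm \<Rightarrow> real ^ 'n) \<Rightarrow> bool" where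
  "proper_biharmonic_map U g V h \<phi> \<longleftrightarrow>
     biharmonic_map U g V h \<phi> \<and> \<not> harmonic_map U g V h \<phi>"

section \<open>Rotationally symmetric surfaces and maps\<close>

text \<open>Coordinate 1 is radial; coordinate 2 is angular and takes values in an open interval of
  \<open>\<real>\<close>: a chart of the circle, or all of \<open>\<real>\<close> as its universal cover.\<close>

definition coord_rect :: "real set \<Rightarrow> real set \<Rightarrow> (real ^ 2) set" where
  "coord_rect I J = {x. x $ 1 \<in> I \<and> x $ 2 \<in> J}"

text \<open>The metric \<open>dr\<^sup>2 + s(r)\<^sup>2 d\<theta>\<^sup>2\<close>.\<close>

definition polar_metric :: "(real \<Rightarrow> real) \<Rightarrow> 2 metric" where
  "polar_metric s x = vector [vector [1, 0], vector [0, (s (x $ 1))\<^sup>2]]"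

definition rot_map :: "(real \<Rightarrow> real) \<Rightarrow> real \<Rightarrow> real ^ 2 \<Rightarrow> real ^ 2" where
  "rot_map \<rho> k x = vector [\<rho> (x $ 1), k * x $ 2]"

end

theory Submission
  imports Defs
begin

text \<open>
  Write \<open>J\<close> for the Jacobi operator of the map, so that the bitension field is \<open>J(\<tau>)\<close>. On a surface,
  both the tension field and the Jacobi operator are conformally covariant: replacing \<open>g\<close> by
  \<open>f\<^sup>-\<^sup>1 g\<close> multiplies the trace by \<open>f\<close>, and the change of the Levi-Civita connection of the domain
  has trace proportional to \<open>2 - m\<close>, which is zero in dimension \<open>m = 2\<close>
  (\<open>trace_christoffel_conformal\<close>, \<open>tension_conformal\<close>, \<open>jacobi_operator_conformal\<close>). Hence the new
  tension field is \<open>f \<tau>\<close>, which has no zeros, and the new bitension field is \<open>f J(f \<tau>)\<close>.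

  The product rule for the Laplacian (\<open>jacobi_operator_scaleR\<close>) gives
  \<open>J(f \<tau>) = f J(\<tau>) + (\<Delta>f) \<tau> + 2 \<nabla>\<tau>(grad f)\<close>, whose first summand is zero since the given map is
  biharmonic; its curvature term need not be computed. For a rotationally symmetric map
  \<open>\<tau> = T(r) \<partial>\<^sub>\<rho>\<close> with \<open>T\<close> the expression that occurs in the definition of \<open>f\<close>
  (\<open>tension_rot_map\<close>), and for a radial \<open>f\<close> what is left is
  \<open>((f'' + (\<sigma>'/\<sigma>) f') T + 2 f' T') \<partial>\<^sub>\<rho>\<close> (\<open>jacobi_operator_radial_multiple\<close>). Multiplied by \<open>T \<sigma>\<close>, the
  bracket is the derivative of \<open>f' T\<^sup>2 \<sigma>\<close>, so it vanishes exactly if \<open>f' T\<^sup>2 \<sigma>\<close> is constant. This is the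
  stated family of functions \<open>f\<close>.

  Smoothness of the new metric requires that \<open>f\<close> is smooth, which follows from the formula for \<open>f'\<close>
  by closure properties of smooth functions.
\<close>

section \<open>Calculus of smooth functions\<close>

text \<open>
  In \<^const>\<open>iter_partial\<close> the recursion peels off the derivative taken last. Induction over
  the order of differentiability peels off the one taken first: the first partial derivatives of a
  product or a composite are again built from products and composites, and are of one order less.
  This predicate, which is class \<open>C\<^sup>n\<close> with one extra derivative and without continuity of the last
  one, is shaped for that induction.
\<close>

fun diff_upto :: "nat \<Rightarrow> 'a::euclidean_space set \<Rightarrow> ('a \<Rightarrow> 'b::real_normed_vector) \<Rightarrow> bool" where
  "diff_upto 0 S F \<longleftrightarrow> (\<forall>x\<in>S. F differentiable (at x))"
| "diff_upto (Suc n) S F \<longleftrightarrow> (\<forall>x\<in>S. F differentiable (at x)) \<and>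
     (\<forall>b\<in>Basis. diff_upto n S (\<lambda>x. frechet_derivative F (at x) b))"

lemma iter_partial_snoc:
  "iter_partial (bs @ [b]) F = iter_partial bs (\<lambda>x. frechet_derivative F (at x) b)"
  by (induction bs) auto

lemma diff_upto_iff_iter_partial:
  "diff_upto n S F \<longleftrightarrow>
     (\<forall>bs. set bs \<subseteq> Basis \<and> length bs \<le> n \<longrightarrow> (\<forall>x\<in>S. iter_partial bs F differentiable (at x)))"
proof (induction n arbitrary: F)
  case 0
  then show ?case by auto
next
  case (Suc n)
  show ?case
  proof
    assume L: "diff_upto (Suc n) S F"
    show "\<forall>bs. set bs \<subseteq> Basis \<and> length bs \<le> Suc n \<longrightarrow> (\<forall>x\<in>S. iter_partial bs F differentiable (at x))"
    proof (intro allI impI)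
      fix bs :: "'a list" assume bs: "set bs \<subseteq> Basis \<and> length bs \<le> Suc n"
      show "\<forall>x\<in>S. iter_partial bs F differentiable (at x)"
      proof (cases bs rule: rev_cases)
        case Nil
        then show ?thesis using L by simp
      next
        case (snoc cs b)
        then have "diff_upto n S (\<lambda>x. frechet_derivative F (at x) b)" using L bs by auto
        then show ?thesis using Suc.IH bs snoc by (auto simp: iter_partial_snoc)
      qed
    qed
  next
    assume R: "\<forall>bs. set bs \<subseteq> Basis \<and> length bs \<le> Suc n \<longrightarrow> (\<forall>x\<in>S. iter_partial bs F differentiable (at x))"
    have "diff_upto n S (\<lambda>x. frechet_derivative F (at x) b)" if "b \<in> Basis" for b
      unfolding Suc.IH using that R
      by (auto simp flip: iter_partial_snoc)
    moreover have "\<forall>x\<in>S. F differentiable (at x)" using R[rule_format, of "[]"] by simp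
    ultimately show "diff_upto (Suc n) S F" by simp
  qed
qed

lemma smooth_on_iff_diff_upto: "smooth_on S F \<longleftrightarrow> (\<forall>n. diff_upto n S F)"
  unfolding smooth_on_def diff_upto_iff_iter_partial by blast

lemma smooth_on_differentiable: "smooth_on S F \<Longrightarrow> x \<in> S \<Longrightarrow> F differentiable (at x)"
  unfolding smooth_on_def by (metis empty_subsetI iter_partial.simps(1) list.set(1))

lemma smooth_on_frechet_derivative:
  "smooth_on S F \<Longrightarrow> b \<in> Basis \<Longrightarrow> smooth_on S (\<lambda>x. frechet_derivative F (at x) b)"
  unfolding smooth_on_iff_diff_upto by (metis diff_upto.simps(2))

lemma smooth_onI:
  assumes "\<And>x. x \<in> S \<Longrightarrow> F differentiable (at x)"
    and "\<And>b. b \<in> Basis \<Longrightarrow> smooth_on S (\<lambda>x. frechet_derivative F (at x) b)"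
  shows "smooth_on S F"
  unfolding smooth_on_iff_diff_upto
proof
  fix n show "diff_upto n S F" using assms unfolding smooth_on_iff_diff_upto by (cases n) auto
qed

lemma diff_upto_Suc_imp: "diff_upto (Suc n) S F \<Longrightarrow> diff_upto n S F"
  by (auto simp: diff_upto_iff_iter_partial)

lemma frechet_derivative_cong_open:
  assumes "open S" "x \<in> S" "\<And>y. y \<in> S \<Longrightarrow> F y = G y"
  shows "frechet_derivative F (at x) = frechet_derivative G (at x)"
proof -
  have "(F has_derivative D) (at x) \<longleftrightarrow> (G has_derivative D) (at x)" for D
    using assms has_derivative_transform_within_open[of F D x UNIV S G]
      has_derivative_transform_within_open[of G D x UNIV S F] by auto
  then show ?thesis unfolding frechet_derivative_def by simp
qed

text \<open>
  The formulas for the derivatives of sums, products and composites hold on \<open>S\<close> only;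
  since \<open>S\<close> is open, they may still be differentiated again.
\<close>

lemma diff_upto_cong:
  assumes "open S" "\<And>x. x \<in> S \<Longrightarrow> F x = G x" "diff_upto n S F"
  shows "diff_upto n S G"
  using assms(2,3)
proof (induction n arbitrary: F G)
  case 0
  then show ?case using assms(1)
    by (auto simp: differentiable_def) (metis has_derivative_transform_within_open)
next
  case (Suc n)
  have "\<forall>x\<in>S. G differentiable (at x)" using assms(1) Suc.prems
    by (auto simp: differentiable_def) (metis has_derivative_transform_within_open)
  moreover have "diff_upto n S (\<lambda>x. frechet_derivative G (at x) b)" if "b \<in> Basis" for b
    using Suc.IH[of "\<lambda>x. frechet_derivative F (at x) b" "\<lambda>x. frechet_derivative G (at x) b"]
      Suc.prems that frechet_derivative_cong_open[OF assms(1), of _ F G] by simp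
  ultimately show ?case by simp
qed

lemma diff_upto_const: "diff_upto n S (\<lambda>_. c)"
proof (induction n arbitrary: c)
  case (Suc n)
  then show ?case by (simp add: frechet_derivative_const)
qed simp

lemma diff_upto_bounded_linear:
  assumes "bounded_linear L"
  shows "diff_upto n S L"
proof (cases n)
  case 0
  then show ?thesis by (simp add: assms bounded_linear_imp_differentiable)
next
  case (Suc m)
  have "frechet_derivative L (at x) = L" for x
    using assms bounded_linear_imp_has_derivative frechet_derivative_at by metis
  then show ?thesis
    using Suc by (simp add: assms bounded_linear_imp_differentiable diff_upto_const)
qed

lemma diff_upto_add:
  assumes "open S" "diff_upto n S F" "diff_upto n S G"
  shows "diff_upto n S (\<lambda>x. F x + G x)"
  using assms(2,3)
proof (induction n arbitrary: F G)
  case (Suc n)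
  have der: "((\<lambda>x. F x + G x) has_derivative
      (\<lambda>h. frechet_derivative F (at x) h + frechet_derivative G (at x) h)) (at x)" if "x \<in> S" for x
    using that Suc.prems by (intro has_derivative_add) (auto simp flip: frechet_derivative_works)
  have "diff_upto n S (\<lambda>x. frechet_derivative (\<lambda>x. F x + G x) (at x) b)" if "b \<in> Basis" for b
  proof (rule diff_upto_cong[OF assms(1)])
    show "diff_upto n S (\<lambda>x. frechet_derivative F (at x) b + frechet_derivative G (at x) b)"
      using Suc that by simp
  qed (simp add: fun_cong[OF frechet_derivative_at[OF der], symmetric])
  then show ?case using Suc.prems by simp
qed simp

text \<open>
  Leibniz: both summands of the derivative are products of functions of the lower order.
\<close>

lemma (in bounded_bilinear) diff_upto_prod:
  assumes "open S" "diff_upto n S F" "diff_upto n S G"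
  shows "diff_upto n S (\<lambda>x. prod (F x) (G x))"
  using assms(2,3)
proof (induction n arbitrary: F G)
  case 0
  show ?case unfolding diff_upto.simps
  proof
    fix x assume "x \<in> S"
    then obtain F' G' where "(F has_derivative F') (at x)" "(G has_derivative G') (at x)"
      using 0 unfolding diff_upto.simps differentiable_def by blast
    then show "(\<lambda>x. prod (F x) (G x)) differentiable (at x)"
      by (rule differentiableI[OF FDERIV])
  qed
next
  case (Suc n)
  have der: "((\<lambda>x. prod (F x) (G x)) has_derivative
      (\<lambda>h. prod (F x) (frechet_derivative G (at x) h) + prod (frechet_derivative F (at x) h) (G x))) (at x)"
    if "x \<in> S" for x
    using that Suc.prems by (intro FDERIV) (auto simp flip: frechet_derivative_works)
  have "diff_upto n S (\<lambda>x. frechet_derivative (\<lambda>x. prod (F x) (G x)) (at x) b)" if "b \<in> Basis" for b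
  proof (rule diff_upto_cong[OF assms(1)])
    show "diff_upto n S (\<lambda>x. prod (F x) (frechet_derivative G (at x) b)
        + prod (frechet_derivative F (at x) b) (G x))"
      using Suc.prems diff_upto_Suc_imp[OF Suc.prems(1)] diff_upto_Suc_imp[OF Suc.prems(2)] that
      by (intro diff_upto_add[OF assms(1)] Suc.IH) simp_all
  qed (simp add: fun_cong[OF frechet_derivative_at[OF der], symmetric])
  then show ?case using differentiableI[OF der] by simp
qed

lemmas diff_upto_mult = bounded_bilinear.diff_upto_prod[OF bounded_bilinear_mult]

lemma diff_upto_inverse:
  fixes F :: "'a::euclidean_space \<Rightarrow> real"
  assumes "open S" "\<And>x. x \<in> S \<Longrightarrow> F x \<noteq> 0" "diff_upto n S F"
  shows "diff_upto n S (\<lambda>x. inverse (F x))"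
  using assms(3)
proof (induction n)
  case 0
  then show ?case using assms(2) by auto
next
  case (Suc n)
  have der: "((\<lambda>x. inverse (F x)) has_derivative
      (\<lambda>h. - (inverse (F x) * frechet_derivative F (at x) h * inverse (F x)))) (at x)" if "x \<in> S" for x
    using that Suc.prems assms(2)
    by (intro Deriv.has_derivative_inverse) (auto simp flip: frechet_derivative_works)
  have "diff_upto n S (\<lambda>x. frechet_derivative (\<lambda>x. inverse (F x)) (at x) b)" if "b \<in> Basis" for b
  proof (rule diff_upto_cong[OF assms(1)])
    show "diff_upto n S (\<lambda>x. (- 1) *
        (inverse (F x) * frechet_derivative F (at x) b * inverse (F x)))"
      using Suc.IH[OF diff_upto_Suc_imp[OF Suc.prems]] Suc.prems that
      by (intro diff_upto_mult[OF assms(1)] diff_upto_const) simp_all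
  next
    fix x assume "x \<in> S"
    from fun_cong[OF frechet_derivative_at[OF der[OF this]], of b]
    show "(- 1) * (inverse (F x) * frechet_derivative F (at x) b * inverse (F x))
        = frechet_derivative (\<lambda>x. inverse (F x)) (at x) b" by simp
  qed
  then show ?case using differentiableI[OF der] by simp
qed

text \<open>
  The derivative \<open>(h' \<circ> F) * \<partial>\<^sub>b F\<close> contains a composite of the same shape with \<open>h'\<close> in place
  of \<open>h\<close>, hence the induction for all \<open>h\<close>.
\<close>

lemma diff_upto_compose:
  fixes F :: "'a::euclidean_space \<Rightarrow> real" and h :: "real \<Rightarrow> real"
  assumes "open S" "F ` S \<subseteq> T" "diff_upto n S F" "diff_upto n T h"
  shows "diff_upto n S (\<lambda>x. h (F x))"
  using assms(3,4)
proof (induction n arbitrary: h)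
  case 0
  show ?case unfolding diff_upto.simps
  proof
    fix x assume "x \<in> S"
    then have "F differentiable (at x)" "h differentiable (at (F x))"
      using 0 assms(2) unfolding diff_upto.simps by blast+
    from differentiable_chain_at[OF this]
    show "(\<lambda>x. h (F x)) differentiable (at x)" unfolding o_def .
  qed
next
  case (Suc n)
  have der: "((\<lambda>x. h (F x)) has_derivative
      (\<lambda>v. frechet_derivative h (at (F x)) (frechet_derivative F (at x) v))) (at x)" if "x \<in> S" for x
  proof -
    have "F differentiable (at x)" "h differentiable (at (F x))"
      using that Suc.prems assms(2) unfolding diff_upto.simps by blast+
    then have "(F has_derivative frechet_derivative F (at x)) (at x)"
      "(h has_derivative frechet_derivative h (at (F x))) (at (F x))"
      by (simp_all only: frechet_derivative_works)
    from diff_chain_at[OF this] show ?thesis unfolding o_def .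
  qed
  have "diff_upto n S (\<lambda>x. frechet_derivative (\<lambda>x. h (F x)) (at x) b)" if "b \<in> Basis" for b
  proof (rule diff_upto_cong[OF assms(1)])
    show "diff_upto n S (\<lambda>x. frechet_derivative h (at (F x)) 1 * frechet_derivative F (at x) b)"
    proof (rule diff_upto_mult[OF assms(1)])
      have "diff_upto n T (\<lambda>y. frechet_derivative h (at y) 1)" using Suc.prems(2) by simp
      then show "diff_upto n S (\<lambda>x. frechet_derivative h (at (F x)) 1)"
        by (rule Suc.IH[OF diff_upto_Suc_imp[OF Suc.prems(1)]])
      show "diff_upto n S (\<lambda>x. frechet_derivative F (at x) b)" using Suc.prems(1) that by simp
    qed
  next
    fix x assume "x \<in> S"
    then have "linear (frechet_derivative h (at (F x)))"
      using Suc.prems assms(2) unfolding diff_upto.simps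
      by (intro linear_frechet_derivative) blast
    from linear_scale[OF this, of "frechet_derivative F (at x) b" 1]
      fun_cong[OF frechet_derivative_at[OF der[OF \<open>x \<in> S\<close>]], of b]
    show "frechet_derivative h (at (F x)) 1 * frechet_derivative F (at x) b
        = frechet_derivative (\<lambda>x. h (F x)) (at x) b" by (simp add: mult.commute)
  qed
  then show ?case using differentiableI[OF der] by simp
qed

lemma smooth_on_cong:
  "open S \<Longrightarrow> (\<And>x. x \<in> S \<Longrightarrow> F x = G x) \<Longrightarrow> smooth_on S F \<Longrightarrow> smooth_on S G"
  unfolding smooth_on_iff_diff_upto using diff_upto_cong by metis

lemma smooth_on_const: "smooth_on S (\<lambda>_. c)"
  unfolding smooth_on_iff_diff_upto by (simp add: diff_upto_const)

lemma smooth_on_bounded_linear: "bounded_linear L \<Longrightarrow> smooth_on S L"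
  unfolding smooth_on_iff_diff_upto by (simp add: diff_upto_bounded_linear)

lemma smooth_on_add:
  "open S \<Longrightarrow> smooth_on S F \<Longrightarrow> smooth_on S G \<Longrightarrow> smooth_on S (\<lambda>x. F x + G x)"
  unfolding smooth_on_iff_diff_upto by (simp add: diff_upto_add)

lemma (in bounded_bilinear) smooth_on_prod:
  "open S \<Longrightarrow> smooth_on S F \<Longrightarrow> smooth_on S G \<Longrightarrow> smooth_on S (\<lambda>x. prod (F x) (G x))"
  unfolding smooth_on_iff_diff_upto using diff_upto_prod by metis

lemmas smooth_on_mult = bounded_bilinear.smooth_on_prod[OF bounded_bilinear_mult]
lemmas smooth_on_scaleR = bounded_bilinear.smooth_on_prod[OF bounded_bilinear_scaleR]

lemma smooth_on_inverse:
  fixes F :: "'a::euclidean_space \<Rightarrow> real"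
  shows "open S \<Longrightarrow> (\<And>x. x \<in> S \<Longrightarrow> F x \<noteq> 0) \<Longrightarrow> smooth_on S F \<Longrightarrow> smooth_on S (\<lambda>x. inverse (F x))"
  unfolding smooth_on_iff_diff_upto by (simp add: diff_upto_inverse)

lemma smooth_on_compose:
  fixes F :: "'a::euclidean_space \<Rightarrow> real" and h :: "real \<Rightarrow> real"
  shows "open S \<Longrightarrow> F ` S \<subseteq> T \<Longrightarrow> smooth_on S F \<Longrightarrow> smooth_on T h \<Longrightarrow> smooth_on S (\<lambda>x. h (F x))"
  unfolding smooth_on_iff_diff_upto using diff_upto_compose by blast

lemma smooth_on_has_real_derivative:
  fixes F :: "real \<Rightarrow> real"
  shows "smooth_on S F \<Longrightarrow> x \<in> S \<Longrightarrow> (F has_real_derivative deriv F x) (at x)"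
  using smooth_on_differentiable[of S F x] by (simp add: DERIV_deriv_iff_real_differentiable)

lemma frechet_derivative_real:
  fixes F :: "real \<Rightarrow> real"
  assumes "(F has_real_derivative D) (at x)"
  shows "frechet_derivative F (at x) h = D * h"
  using frechet_derivative_at[OF assms[unfolded has_field_derivative_def]] by metis

lemma smooth_on_deriv:
  fixes F :: "real \<Rightarrow> real"
  assumes "open S" "smooth_on S F"
  shows "smooth_on S (deriv F)"
proof (rule smooth_on_cong[OF assms(1)])
  show "smooth_on S (\<lambda>x. frechet_derivative F (at x) 1)"
    using smooth_on_frechet_derivative[OF assms(2), of 1] by simp
  show "frechet_derivative F (at x) 1 = deriv F x" if "x \<in> S" for x
    using frechet_derivative_real[OF smooth_on_has_real_derivative[OF assms(2) that], of 1] by simp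
qed

text \<open>
  This is how smoothness of the conformal factor is obtained: only its derivative is given
  by a formula.
\<close>

lemma smooth_on_antiderivative:
  fixes F :: "real \<Rightarrow> real"
  assumes "open S" "smooth_on S D" "\<And>x. x \<in> S \<Longrightarrow> (F has_real_derivative D x) (at x)"
  shows "smooth_on S F"
proof (rule smooth_onI)
  show "F differentiable (at x)" if "x \<in> S" for x
    using assms(3)[OF that] real_differentiable_def by blast
  show "smooth_on S (\<lambda>x. frechet_derivative F (at x) b)" if "b \<in> Basis" for b
    using that by (intro smooth_on_cong[OF assms(1) _ assms(2)])
      (simp add: frechet_derivative_real[OF assms(3)])
qed

section \<open>Linear algebra and differentiation rules\<close>

lemma matrix_inv_inverse:
  assumes "invertible (A :: real ^ 'n::finite ^ 'n)"
  shows "A ** matrix_inv A = mat 1" "matrix_inv A ** A = mat 1"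
  using someI_ex[OF assms[unfolded invertible_def]] unfolding matrix_inv_def by auto

lemma matrix_inv_eqI:
  assumes "(A :: real ^ 'n::finite ^ 'n) ** B = mat 1" "B ** A = mat 1"
  shows "matrix_inv A = B"
proof -
  have "invertible A" using assms unfolding invertible_def by blast
  then show ?thesis
    by (metis assms(2) matrix_inv_inverse(1) matrix_mul_assoc matrix_mul_lid matrix_mul_rid)
qed

lemma matrix_mult_scaleR_scaleR:
  "(a *\<^sub>R A) ** (b *\<^sub>R B) = (a * b) *\<^sub>R ((A :: real ^ 'n::finite ^ 'm) ** (B :: real ^ 'l ^ 'n))"
  by (simp add: vec_eq_iff matrix_matrix_mult_def sum_distrib_left mult_ac)

lemma matrix_inv_scaleR:
  assumes "invertible (A :: real ^ 'n::finite ^ 'n)" "c \<noteq> 0"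
  shows "matrix_inv (c *\<^sub>R A) = (1 / c) *\<^sub>R matrix_inv A"
  by (rule matrix_inv_eqI) (use assms(2) in
    \<open>simp_all add: matrix_mult_scaleR_scaleR matrix_inv_inverse[OF assms(1)]\<close>)

lemma positive_definite_invertible:
  fixes A :: "real ^ 'n::finite ^ 'n"
  assumes "\<And>v. v \<noteq> 0 \<Longrightarrow> v \<bullet> (A *v v) > 0"
  shows "invertible A"
proof -
  have "\<forall>v. A *v v = 0 \<longrightarrow> v = 0" using assms by fastforce
  then show ?thesis using matrix_left_invertible_ker invertible_left_inverse by blast
qed

lemma frechet_derivative_bounded_bilinear:
  assumes "bounded_bilinear B" "F differentiable (at x)" "G differentiable (at x)"
  shows "frechet_derivative (\<lambda>y. B (F y) (G y)) (at x) h
    = B (F x) (frechet_derivative G (at x) h) + B (frechet_derivative F (at x) h) (G x)"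
    and "(\<lambda>y. B (F y) (G y)) differentiable (at x)"
proof -
  have "(F has_derivative frechet_derivative F (at x)) (at x)"
    "(G has_derivative frechet_derivative G (at x)) (at x)"
    using assms(2,3) by (simp_all only: frechet_derivative_works)
  note D = bounded_bilinear.FDERIV[OF assms(1) this]
  show "frechet_derivative (\<lambda>y. B (F y) (G y)) (at x) h
    = B (F x) (frechet_derivative G (at x) h) + B (frechet_derivative F (at x) h) (G x)"
    using fun_cong[OF frechet_derivative_at[OF D], of h] by simp
  show "(\<lambda>y. B (F y) (G y)) differentiable (at x)" using D by (rule differentiableI)
qed

lemmas frechet_derivative_scaleR_fun =
  frechet_derivative_bounded_bilinear(1)[OF bounded_bilinear_scaleR]
lemmas differentiable_scaleR_fun =
  frechet_derivative_bounded_bilinear(2)[OF bounded_bilinear_scaleR]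

lemma frechet_derivative_add_fun:
  assumes "F differentiable (at x)" "G differentiable (at x)"
  shows "frechet_derivative (\<lambda>y. F y + G y) (at x) h
    = frechet_derivative F (at x) h + frechet_derivative G (at x) h"
proof -
  have "(F has_derivative frechet_derivative F (at x)) (at x)"
    "(G has_derivative frechet_derivative G (at x)) (at x)"
    using assms by (simp_all only: frechet_derivative_works)
  from fun_cong[OF frechet_derivative_at[OF has_derivative_add[OF this]], of h]
  show ?thesis by simp
qed

lemma differentiable_nth:
  "F differentiable (at x) \<Longrightarrow> (\<lambda>y. F y $ i) differentiable (at x)"
  unfolding differentiable_def
  using bounded_linear.has_derivative[OF bounded_linear_vec_nth] by blast

section \<open>Conformal covariance on surfaces\<close>

lemma metric_trace_add:
  "metric_trace g x (\<lambda>i j. A i j + B i j) = metric_trace g x A + metric_trace g x B"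
  by (simp add: metric_trace_def scaleR_add_right sum.distrib)

lemma metric_trace_diff:
  "metric_trace g x (\<lambda>i j. A i j - B i j) = metric_trace g x A - metric_trace g x B"
  by (simp add: metric_trace_def scaleR_diff_right sum_subtractf)

lemma linear_metric_trace:
  assumes "linear L"
  shows "metric_trace g x (\<lambda>i j. L (B i j)) = L (metric_trace g x B)"
  by (simp add: metric_trace_def linear_sum[OF assms] linear_scale[OF assms])

lemma metric_trace_scaleR:
  "metric_trace g x (\<lambda>i j. c *\<^sub>R B i j) = c *\<^sub>R metric_trace g x B"
  by (simp add: metric_trace_def scaleR_sum_right mult.commute)

lemma metric_trace_conformal:
  assumes "invertible (g x)" "c x \<noteq> 0"
  shows "metric_trace (\<lambda>y. c y *\<^sub>R g y) x B = (1 / c x) *\<^sub>R metric_trace g x B"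
  by (simp add: metric_trace_def matrix_inv_scaleR[OF assms] scaleR_sum_right)

lemma christoffel_conformal:
  fixes g :: "'m::finite metric"
  assumes "invertible (g x)" "c x \<noteq> 0" "g differentiable (at x)" "c differentiable (at x)"
  shows "christoffel (\<lambda>y. c y *\<^sub>R g y) k i j x = christoffel g k i j x
    + (1 / (2 * c x)) * (\<Sum>l\<in>UNIV. matrix_inv (g x) $ k $ l *
        (partial i c x * g x $ j $ l + partial j c x * g x $ i $ l - partial l c x * g x $ i $ j))"
proof -
  have p: "partial a (\<lambda>y. c y * g y $ b $ d) x
      = c x * partial a (\<lambda>y. g y $ b $ d) x + partial a c x * g x $ b $ d" for a b d
    unfolding partial_def
    using frechet_derivative_bounded_bilinear(1)[OF bounded_bilinear_mult assms(4)
        differentiable_nth[OF differentiable_nth[OF assms(3)]]] by simp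
  have e: "(1 / c * G) * (c * p1 + q1 + (c * p2 + q2) - (c * p3 + q3))
      = G * (p1 + p2 - p3) + (1 / c) * (G * (q1 + q2 - q3))" if "c \<noteq> 0"
      for c G p1 p2 p3 q1 q2 q3 :: real
    using that by (simp add: field_simps)
  show ?thesis
    unfolding christoffel_def p matrix_inv_scaleR[OF assms(1,2)] vector_scaleR_component
      real_scaleR_def e[OF assms(2)] sum.distrib
    by (simp add: distrib_left flip: sum_distrib_left sum_divide_distrib)
qed

text \<open>
  This is where the dimension enters. By the preceding formula the \<open>g\<close>-trace of the connection of
  \<open>c g\<close> differs from that of \<open>g\<close> by \<open>(2 - m) / (2 c)\<close> times the gradient of \<open>c\<close>: two of the three
  terms contribute one gradient each, the third contributes \<open>-m\<close> gradients since
  \<open>g\<^sup>i\<^sup>j g\<^sub>i\<^sub>j = m\<close>. So it vanishes for surfaces.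
\<close>

lemma trace_christoffel_conformal:
  fixes g :: "'m::finite metric"
  assumes "CARD('m) = 2" "transpose (g x) = g x"
    and "invertible (g x)" "c x \<noteq> 0" "g differentiable (at x)" "c differentiable (at x)"
  shows "(\<Sum>i\<in>UNIV. \<Sum>j\<in>UNIV. matrix_inv (g x) $ i $ j * christoffel (\<lambda>y. c y *\<^sub>R g y) k i j x)
    = (\<Sum>i\<in>UNIV. \<Sum>j\<in>UNIV. matrix_inv (g x) $ i $ j * christoffel g k i j x)"
proof -
  let ?G = "matrix_inv (g x)" and ?g = "g x"
  define d where "d l = partial l c x" for l
  have sym: "?g $ a $ b = ?g $ b $ a" for a b
    using assms(2) by (metis transpose_def vec_lambda_beta)
  have A: "(\<Sum>j\<in>UNIV. ?G $ i $ j * ?g $ j $ l) = (if i = l then 1 else 0)" for i l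
    using arg_cong[OF matrix_inv_inverse(2)[OF assms(3)], of "\<lambda>M. M $ i $ l"]
    by (simp add: matrix_matrix_mult_def mat_def)
  have B: "(\<Sum>i\<in>UNIV. ?G $ i $ j * ?g $ i $ l) = (if j = l then 1 else 0)" for j l
    using arg_cong[OF matrix_inv_inverse(1)[OF assms(3)], of "\<lambda>M. M $ l $ j"]
    by (simp add: matrix_matrix_mult_def mat_def sym[of l] mult.commute eq_commute)
  \<comment> \<open>The three terms of the difference of the Christoffel symbols, contracted with the inverse metric.\<close>
  have T1: "(\<Sum>i\<in>UNIV. \<Sum>j\<in>UNIV. ?G $ i $ j * (d i * ?g $ j $ l)) = d l" for l
  proof -
    have "(\<Sum>i\<in>UNIV. \<Sum>j\<in>UNIV. ?G $ i $ j * (d i * ?g $ j $ l))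
        = (\<Sum>i\<in>UNIV. d i * (\<Sum>j\<in>UNIV. ?G $ i $ j * ?g $ j $ l))"
      by (simp add: sum_distrib_left mult_ac)
    then show ?thesis by (simp add: A if_distrib cong: if_cong)
  qed
  have T2: "(\<Sum>i\<in>UNIV. \<Sum>j\<in>UNIV. ?G $ i $ j * (d j * ?g $ i $ l)) = d l" for l
  proof -
    have "(\<Sum>i\<in>UNIV. \<Sum>j\<in>UNIV. ?G $ i $ j * (d j * ?g $ i $ l))
        = (\<Sum>j\<in>UNIV. d j * (\<Sum>i\<in>UNIV. ?G $ i $ j * ?g $ i $ l))"
      by (subst sum.swap) (simp add: sum_distrib_left mult_ac)
    then show ?thesis by (simp add: B if_distrib cong: if_cong)
  qed
  have T3: "(\<Sum>i\<in>UNIV. \<Sum>j\<in>UNIV. ?G $ i $ j * (d l * ?g $ i $ j)) = 2 * d l" for l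
  proof -
    have "(\<Sum>i\<in>UNIV. \<Sum>j\<in>UNIV. ?G $ i $ j * (d l * ?g $ i $ j))
        = d l * (\<Sum>i\<in>UNIV. \<Sum>j\<in>UNIV. ?G $ i $ j * ?g $ j $ i)"
      by (simp add: sum_distrib_left mult_ac sym)
    then show ?thesis using assms(1) by (simp add: A)
  qed
  let ?S = "\<lambda>i j. \<Sum>l\<in>UNIV. ?G $ k $ l * (d i * ?g $ j $ l + d j * ?g $ i $ l - d l * ?g $ i $ j)"
  have "(\<Sum>i\<in>UNIV. \<Sum>j\<in>UNIV. ?G $ i $ j * ?S i j)
      = (\<Sum>l\<in>UNIV. \<Sum>i\<in>UNIV. \<Sum>j\<in>UNIV. ?G $ i $ j *
          (?G $ k $ l * (d i * ?g $ j $ l + d j * ?g $ i $ l - d l * ?g $ i $ j)))"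
    unfolding sum_distrib_left
    by (subst (2) sum.swap) (intro sum.cong refl sum.swap)
  also have "\<dots> = (\<Sum>l\<in>UNIV. ?G $ k $ l *
        ((\<Sum>i\<in>UNIV. \<Sum>j\<in>UNIV. ?G $ i $ j * (d i * ?g $ j $ l))
        + (\<Sum>i\<in>UNIV. \<Sum>j\<in>UNIV. ?G $ i $ j * (d j * ?g $ i $ l))
        - (\<Sum>i\<in>UNIV. \<Sum>j\<in>UNIV. ?G $ i $ j * (d l * ?g $ i $ j))))"
    by (simp add: sum_distrib_left algebra_simps flip: sum.distrib sum_subtractf)
  also have "\<dots> = 0" by (simp add: T1 T2 T3)
  finally have Z: "(\<Sum>i\<in>UNIV. \<Sum>j\<in>UNIV. ?G $ i $ j * ?S i j) = 0" .
  have "(\<Sum>i\<in>UNIV. \<Sum>j\<in>UNIV. ?G $ i $ j * christoffel (\<lambda>y. c y *\<^sub>R g y) k i j x)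
      = (\<Sum>i\<in>UNIV. \<Sum>j\<in>UNIV. ?G $ i $ j * christoffel g k i j x)
        + 1 / (2 * c x) * (\<Sum>i\<in>UNIV. \<Sum>j\<in>UNIV. ?G $ i $ j * ?S i j)"
    unfolding christoffel_conformal[OF assms(3-6)] d_def[symmetric] distrib_left sum.distrib
    by (simp only: mult.left_commute[of _ "1 / (2 * c x)"] sum_distrib_left[symmetric])
  then show ?thesis using Z by simp
qed

lemma christoffel_form_axis:
  "christoffel_form g x (axis i 1) (axis j 1) = (\<chi> k. christoffel g k i j x)"
  by (simp add: christoffel_form_def vec_eq_iff axis_def if_distrib[of "\<lambda>z. _ * z"]
      if_distrib[of "\<lambda>z. z * _"] cong: if_cong)

lemma cov_deriv_frame: "cov_deriv g (frame i) (frame j) x = (\<chi> k. christoffel g k i j x)"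
  by (simp add: cov_deriv_def frame_def christoffel_form_axis frechet_derivative_const)

text \<open>
  Both the tension field and the rough Laplacian are traces of a second derivative minus
  a first-order operator applied to \<open>\<nabla>\<^sub>i e\<^sub>j\<close>. The metric of the domain enters only through the
  trace and through this correction, so on a surface a conformal change merely rescales.
\<close>

lemma metric_trace_connection_conformal:
  fixes g :: "'m::finite metric"
  assumes "CARD('m) = 2" "transpose (g x) = g x"
    and "invertible (g x)" "c x \<noteq> 0" "g differentiable (at x)" "c differentiable (at x)"
    and "linear L"
  shows "metric_trace (\<lambda>y. c y *\<^sub>R g y) x
      (\<lambda>i j. A i j - L (cov_deriv (\<lambda>y. c y *\<^sub>R g y) (frame i) (frame j) x))
    = (1 / c x) *\<^sub>R metric_trace g x (\<lambda>i j. A i j - L (cov_deriv g (frame i) (frame j) x))"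
proof -
  have "metric_trace g x (\<lambda>i j. cov_deriv (\<lambda>y. c y *\<^sub>R g y) (frame i) (frame j) x)
      = metric_trace g x (\<lambda>i j. cov_deriv g (frame i) (frame j) x)"
    using trace_christoffel_conformal[OF assms(1-6)]
    by (simp add: metric_trace_def cov_deriv_frame vec_eq_iff)
  then show ?thesis
    by (simp add: metric_trace_conformal[of g x c, OF assms(3,4)] metric_trace_diff
        linear_metric_trace[OF assms(7)] linear_scale[OF assms(7)] scaleR_diff_right)
qed

lemma linear_christoffel_form_left: "linear (\<lambda>u. christoffel_form h y u v)"
  by (intro linearI)
    (simp_all add: christoffel_form_def vec_eq_iff algebra_simps sum.distrib sum_distrib_left)

lemma linear_christoffel_form_right: "linear (christoffel_form h y u)"
  by (intro linearI)
    (simp_all add: christoffel_form_def vec_eq_iff algebra_simps sum.distrib sum_distrib_left)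

lemma tension_conformal:
  fixes g :: "'m::finite metric"
  assumes "CARD('m) = 2" "transpose (g x) = g x"
    and "invertible (g x)" "c x \<noteq> 0" "g differentiable (at x)" "c differentiable (at x)"
    and "\<phi> differentiable (at x)"
  shows "tension (\<lambda>y. c y *\<^sub>R g y) h \<phi> x = (1 / c x) *\<^sub>R tension g h \<phi> x"
  using metric_trace_connection_conformal[OF assms(1-6) linear_frechet_derivative[OF assms(7)]]
  by (simp add: tension_def second_fundamental_form_def push_def)

lemma rough_laplacian_conformal:
  fixes g :: "'m::finite metric"
  assumes "CARD('m) = 2" "transpose (g x) = g x"
    and "invertible (g x)" "c x \<noteq> 0" "g differentiable (at x)" "c differentiable (at x)"
    and "\<phi> differentiable (at x)" "V differentiable (at x)"
  shows "rough_laplacian (\<lambda>y. c y *\<^sub>R g y) h \<phi> V x = (1 / c x) *\<^sub>R rough_laplacian g h \<phi> V x"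
proof -
  let ?L = "\<lambda>w. frechet_derivative V (at x) w
    + christoffel_form h (\<phi> x) (frechet_derivative \<phi> (at x) w) (V x)"
  have "linear ?L"
    using linear_compose[OF linear_frechet_derivative[OF assms(7)] linear_christoffel_form_left]
    by (intro linear_compose_add linear_frechet_derivative[OF assms(8)]) (simp add: o_def)
  from metric_trace_connection_conformal[OF assms(1-6) this]
  show ?thesis
    unfolding rough_laplacian_def pullback_cov_def[of h \<phi> "cov_deriv _ _ _"] push_def .
qed

text \<open>
  Up to sign this is the second variation of the energy at a harmonic map; here it is used along any map,
  the bitension field being its value on the tension field.
\<close>

definition jacobi_operator :: "'m::finite metric \<Rightarrow> 'n::finite metric \<Rightarrow>
    (real ^ 'm \<Rightarrow> real ^ 'n) \<Rightarrow> (real ^ 'm \<Rightarrow> real ^ 'n) \<Rightarrow> real ^ 'm \<Rightarrow> real ^ 'n" where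
  "jacobi_operator g h \<phi> V x = rough_laplacian g h \<phi> V x
     - metric_trace g x (\<lambda>i j. riemann_at h (\<phi> x) (push \<phi> (frame i) x) (V x) (push \<phi> (frame j) x))"

lemma bitension_eq_jacobi_operator:
  "bitension g h \<phi> = jacobi_operator g h \<phi> (tension g h \<phi>)"
  by (simp add: fun_eq_iff bitension_def jacobi_operator_def)

lemma jacobi_operator_conformal:
  fixes g :: "'m::finite metric"
  assumes "CARD('m) = 2" "transpose (g x) = g x"
    and "invertible (g x)" "c x \<noteq> 0" "g differentiable (at x)" "c differentiable (at x)"
    and "\<phi> differentiable (at x)" "V differentiable (at x)"
  shows "jacobi_operator (\<lambda>y. c y *\<^sub>R g y) h \<phi> V x = (1 / c x) *\<^sub>R jacobi_operator g h \<phi> V x"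
  by (simp only: jacobi_operator_def rough_laplacian_conformal[OF assms]
      metric_trace_conformal[of g x c, OF assms(3,4)] scaleR_diff_right)

lemma pullback_cov_cong:
  assumes "open U" "x \<in> U" "\<And>y. y \<in> U \<Longrightarrow> V y = W y"
  shows "pullback_cov h \<phi> X V x = pullback_cov h \<phi> X W x"
  using frechet_derivative_cong_open[OF assms] assms(2,3) by (simp add: pullback_cov_def)

lemma jacobi_operator_cong:
  assumes "open U" "x \<in> U" "\<And>y. y \<in> U \<Longrightarrow> V y = W y"
  shows "jacobi_operator g h \<phi> V x = jacobi_operator g h \<phi> W x"
proof -
  have "pullback_cov h \<phi> X (pullback_cov h \<phi> Y V) x = pullback_cov h \<phi> X (pullback_cov h \<phi> Y W) x" for X Y
    by (rule pullback_cov_cong[OF assms(1,2)]) (rule pullback_cov_cong[OF assms(1) _ assms(3)])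
  then show ?thesis
    using assms(2,3) pullback_cov_cong[OF assms] by (simp add: jacobi_operator_def rough_laplacian_def)
qed

section \<open>The Jacobi operator and multiplication by functions\<close>

text \<open>
  With constant coefficient fields the Lie bracket vanishes, and the curvature is the usual expression
  in the Christoffel symbols and their first derivatives.
\<close>

lemma riemann_at_eq:
  "riemann_at h y u v w =
     frechet_derivative (\<lambda>z. christoffel_form h z v w) (at y) u
     + christoffel_form h y u (christoffel_form h y v w)
     - frechet_derivative (\<lambda>z. christoffel_form h z u w) (at y) v
     - christoffel_form h y v (christoffel_form h y u w)"
proof -
  have "cov_deriv h (\<lambda>_. a) (\<lambda>_. b) = (\<lambda>z. christoffel_form h z a b)" for a b
    by (simp add: fun_eq_iff cov_deriv_def frechet_derivative_const)
  moreover have "cov_deriv h (lie_bracket (\<lambda>_. u) (\<lambda>_. v)) (\<lambda>_. w) y = 0"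
    by (simp add: cov_deriv_def lie_bracket_def frechet_derivative_const
        linear_0[OF linear_christoffel_form_left])
  ultimately show ?thesis by (simp add: riemann_at_def riemann_def cov_deriv_def)
qed

lemma riemann_at_scaleR_middle:
  assumes "\<And>a b. (\<lambda>z. christoffel_form h z a b) differentiable (at y)"
  shows "riemann_at h y u (c *\<^sub>R v) w = c *\<^sub>R riemann_at h y u v w"
proof -
  have s: "christoffel_form h z (c *\<^sub>R v) b = c *\<^sub>R christoffel_form h z v b" for z b
    by (rule linear_scale[OF linear_christoffel_form_left])
  have "frechet_derivative (\<lambda>z. c *\<^sub>R christoffel_form h z v w) (at y) u
      = c *\<^sub>R frechet_derivative (\<lambda>z. christoffel_form h z v w) (at y) u"
    using frechet_derivative_scaleR_fun[OF differentiable_const assms, of c v w u]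
    by (simp add: frechet_derivative_const)
  moreover have "frechet_derivative (\<lambda>z. christoffel_form h z u w) (at y) (c *\<^sub>R v)
      = c *\<^sub>R frechet_derivative (\<lambda>z. christoffel_form h z u w) (at y) v"
    by (rule linear_scale[OF linear_frechet_derivative[OF assms]])
  ultimately show ?thesis
    unfolding riemann_at_eq s by (simp add: algebra_simps linear_scale[OF linear_christoffel_form_right])
qed

lemma pullback_cov_add:
  assumes "V differentiable (at x)" "W differentiable (at x)"
  shows "pullback_cov h \<phi> X (\<lambda>y. V y + W y) x = pullback_cov h \<phi> X V x + pullback_cov h \<phi> X W x"
  by (simp add: pullback_cov_def frechet_derivative_add_fun[OF assms]
      linear_add[OF linear_christoffel_form_right])

lemma pullback_cov_scaleR:
  assumes "u differentiable (at x)" "V differentiable (at x)"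
  shows "pullback_cov h \<phi> X (\<lambda>y. u y *\<^sub>R V y) x
    = frechet_derivative u (at x) (X x) *\<^sub>R V x + u x *\<^sub>R pullback_cov h \<phi> X V x"
  by (simp add: pullback_cov_def frechet_derivative_scaleR_fun[OF assms]
      linear_scale[OF linear_christoffel_form_right] algebra_simps)

definition laplace_beltrami :: "'m::finite metric \<Rightarrow> (real ^ 'm \<Rightarrow> real) \<Rightarrow> real ^ 'm \<Rightarrow> real" where
  "laplace_beltrami g u x = (\<Sum>i\<in>UNIV. \<Sum>j\<in>UNIV. matrix_inv (g x) $ i $ j *
     (partial i (partial j u) x - frechet_derivative u (at x) (cov_deriv g (frame i) (frame j) x)))"

text \<open>
  The curvature term is linear over functions, so only the Laplacian sees derivatives of \<open>u\<close>. The
  last trace is \<open>2 \<nabla>V(grad u)\<close>, written symmetrically in the two indices.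
\<close>

lemma jacobi_operator_scaleR:
  assumes U: "open U" "x \<in> U"
    and u: "\<And>y. y \<in> U \<Longrightarrow> u differentiable (at y)" "\<And>j. partial j u differentiable (at x)"
    and V: "\<And>y. y \<in> U \<Longrightarrow> V differentiable (at y)"
      "\<And>j. pullback_cov h \<phi> (frame j) V differentiable (at x)"
    and h: "\<And>a b. (\<lambda>z. christoffel_form h z a b) differentiable (at (\<phi> x))"
  shows "jacobi_operator g h \<phi> (\<lambda>y. u y *\<^sub>R V y) x
    = u x *\<^sub>R jacobi_operator g h \<phi> V x + laplace_beltrami g u x *\<^sub>R V x
      + metric_trace g x (\<lambda>i j. partial i u x *\<^sub>R pullback_cov h \<phi> (frame j) V x
          + partial j u x *\<^sub>R pullback_cov h \<phi> (frame i) V x)"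
proof -
  let ?D = "\<lambda>i. pullback_cov h \<phi> (frame i)"
  have D: "?D i (\<lambda>y. w y *\<^sub>R W y) y = partial i w y *\<^sub>R W y + w y *\<^sub>R ?D i W y"
    if "w differentiable (at y)" "W differentiable (at y)" for i w W y
    using pullback_cov_scaleR[OF that, of h \<phi> "frame i"] by (simp add: partial_def frame_def)
  have DD: "?D i (?D j (\<lambda>y. u y *\<^sub>R V y)) x
      = partial i (partial j u) x *\<^sub>R V x + u x *\<^sub>R ?D i (?D j V) x
        + (partial i u x *\<^sub>R ?D j V x + partial j u x *\<^sub>R ?D i V x)" for i j
  proof -
    have "?D i (?D j (\<lambda>y. u y *\<^sub>R V y)) x
        = ?D i (\<lambda>y. partial j u y *\<^sub>R V y + u y *\<^sub>R ?D j V y) x"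
      using D u(1) V(1) by (intro pullback_cov_cong[OF U]) simp
    also have "\<dots> = ?D i (\<lambda>y. partial j u y *\<^sub>R V y) x + ?D i (\<lambda>y. u y *\<^sub>R ?D j V y) x"
      using U u V by (intro pullback_cov_add differentiable_scaleR_fun) auto
    also have "\<dots> = partial i (partial j u) x *\<^sub>R V x + partial j u x *\<^sub>R ?D i V x
        + (partial i u x *\<^sub>R ?D j V x + u x *\<^sub>R ?D i (?D j V) x)"
      using D U u V by simp
    finally show ?thesis by simp
  qed
  have "rough_laplacian g h \<phi> (\<lambda>y. u y *\<^sub>R V y) x = metric_trace g x (\<lambda>i j.
      u x *\<^sub>R (?D i (?D j V) x - pullback_cov h \<phi> (cov_deriv g (frame i) (frame j)) V x)
      + (partial i (partial j u) x
          - frechet_derivative u (at x) (cov_deriv g (frame i) (frame j) x)) *\<^sub>R V x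
      + (partial i u x *\<^sub>R ?D j V x + partial j u x *\<^sub>R ?D i V x))"
    unfolding rough_laplacian_def DD pullback_cov_scaleR[OF u(1)[OF U(2)] V(1)[OF U(2)]]
    by (simp add: algebra_simps)
  also have "\<dots> = u x *\<^sub>R rough_laplacian g h \<phi> V x + laplace_beltrami g u x *\<^sub>R V x
      + metric_trace g x (\<lambda>i j. partial i u x *\<^sub>R ?D j V x + partial j u x *\<^sub>R ?D i V x)"
    unfolding metric_trace_add[where B = "\<lambda>i j. partial i u x *\<^sub>R ?D j V x + partial j u x *\<^sub>R ?D i V x"]
      metric_trace_add[where B = "\<lambda>i j. _ i j *\<^sub>R V x"] metric_trace_scaleR rough_laplacian_def
    by (simp add: metric_trace_def laplace_beltrami_def scaleR_sum_left)
  finally show ?thesis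
    unfolding jacobi_operator_def riemann_at_scaleR_middle[OF h] metric_trace_scaleR
    by (simp add: algebra_simps)
qed

section \<open>Polar metrics and rotationally symmetric maps\<close>

lemma vector_2_eq: "vector [a, b] = a *\<^sub>R axis 1 1 + b *\<^sub>R (axis 2 1 :: real ^ 2)"
  by (simp add: vec_eq_iff forall_2 axis_def)

lemma vector_2_has_derivative:
  assumes "(a has_derivative a') (at x)" "(b has_derivative b') (at x)"
  shows "((\<lambda>y. vector [a y, b y] :: real ^ 2) has_derivative (\<lambda>v. vector [a' v, b' v])) (at x)"
  unfolding vector_2_eq
  by (intro has_derivative_add has_derivative_scaleR_left assms)

lemma radial_has_derivative:
  fixes x :: "real ^ 'n::finite"
  assumes "(q has_real_derivative q') (at (x $ i))"
  shows "((\<lambda>y. q (y $ i)) has_derivative (\<lambda>v. q' * v $ i)) (at x)"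
  using has_derivative_compose[OF bounded_linear_imp_has_derivative[OF bounded_linear_vec_nth]
    assms[unfolded has_field_derivative_def]] .

lemma polar_metric_nth [simp]:
  "polar_metric s x $ 1 $ 1 = 1" "polar_metric s x $ 1 $ 2 = 0"
  "polar_metric s x $ 2 $ 1 = 0" "polar_metric s x $ 2 $ 2 = (s (x $ 1))\<^sup>2"
  by (simp_all add: polar_metric_def)

lemma matrix_inv_polar_metric:
  assumes "s (x $ 1) \<noteq> 0"
  shows "matrix_inv (polar_metric s x) = vector [vector [1, 0], vector [0, 1 / (s (x $ 1))\<^sup>2]]"
  using assms
  by (intro matrix_inv_eqI)
    (simp_all add: vec_eq_iff forall_2 matrix_matrix_mult_def sum_2 mat_def)

lemma metric_trace_polar_metric:
  assumes "s (x $ 1) \<noteq> 0"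
  shows "metric_trace (polar_metric s) x B = B 1 1 + (1 / (s (x $ 1))\<^sup>2) *\<^sub>R B 2 2"
  by (simp add: metric_trace_def sum_2 matrix_inv_polar_metric[of s x, OF assms])

lemma christoffel_form_polar_metric:
  assumes "(s has_real_derivative s') (at (x $ 1))" "s (x $ 1) \<noteq> 0"
  shows "christoffel_form (polar_metric s) x u v
    = vector [- s (x $ 1) * s' * u $ 2 * v $ 2, s' / s (x $ 1) * (u $ 1 * v $ 2 + u $ 2 * v $ 1)]"
proof -
  have "((\<lambda>r. (s r)\<^sup>2) has_real_derivative 2 * s (x $ 1) * s') (at (x $ 1))"
    by (auto intro!: derivative_eq_intros assms(1))
  from frechet_derivative_at[OF radial_has_derivative[OF this]]
  have "frechet_derivative (\<lambda>y. (s (y $ 1))\<^sup>2) (at x) = (\<lambda>v. 2 * s (x $ 1) * s' * v $ 1)"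
    by (rule sym)
  then have "partial i (\<lambda>y. (s (y $ 1))\<^sup>2) x = (if i = 1 then 2 * s (x $ 1) * s' else 0)" for i
    by (simp add: partial_def axis_def)
  moreover have "partial i (\<lambda>_. c) x = 0" for i and c :: real
    by (simp add: partial_def frechet_derivative_const)
  ultimately show ?thesis
    using assms(2)
    by (simp add: vec_eq_iff forall_2 christoffel_form_def christoffel_def sum_2
        matrix_inv_polar_metric[of s x, OF assms(2)] field_simps power2_eq_square)
qed

lemma rot_map_has_derivative:
  assumes "(\<rho> has_real_derivative \<rho>') (at (x $ 1))"
  shows "(rot_map \<rho> k has_derivative (\<lambda>v. vector [\<rho>' * v $ 1, k * v $ 2])) (at x)"
  unfolding rot_map_def
  by (intro vector_2_has_derivative radial_has_derivative[OF assms] derivative_eq_intros refl)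
    (auto intro!: bounded_linear_imp_has_derivative bounded_linear_vec_nth)

lemma push_rot_map:
  assumes "(\<rho> has_real_derivative \<rho>') (at (x $ 1))"
  shows "push (rot_map \<rho> k) X x = vector [\<rho>' * X x $ 1, k * X x $ 2]"
  unfolding push_def frechet_derivative_at[OF rot_map_has_derivative[OF assms], symmetric] ..

text \<open>
  Fields along the map whose coordinates depend on the radius alone are closed under covariant
  differentiation in coordinate directions, so all of the remaining differentiations reduce to one variable.
\<close>

lemma pullback_cov_rot_map:
  assumes "(\<rho> has_real_derivative \<rho>') (at (x $ 1))"
    and "(l has_real_derivative l') (at (\<rho> (x $ 1)))" "l (\<rho> (x $ 1)) \<noteq> 0"
    and "(a has_real_derivative a') (at (x $ 1))" "(b has_real_derivative b') (at (x $ 1))"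
  shows "pullback_cov (polar_metric l) (rot_map \<rho> k) X (\<lambda>y. vector [a (y $ 1), b (y $ 1)]) x
    = vector [a' * X x $ 1 - l (\<rho> (x $ 1)) * l' * k * b (x $ 1) * X x $ 2,
        b' * X x $ 1 + l' / l (\<rho> (x $ 1)) * (\<rho>' * b (x $ 1) * X x $ 1 + k * a (x $ 1) * X x $ 2)]"
proof -
  have "rot_map \<rho> k x $ 1 = \<rho> (x $ 1)" by (simp add: rot_map_def)
  then have G: "christoffel_form (polar_metric l) (rot_map \<rho> k x) u v
      = vector [- l (\<rho> (x $ 1)) * l' * u $ 2 * v $ 2,
          l' / l (\<rho> (x $ 1)) * (u $ 1 * v $ 2 + u $ 2 * v $ 1)]" for u v
    using christoffel_form_polar_metric[of l l' "rot_map \<rho> k x" u v] assms(2,3) by simp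
  have "frechet_derivative (\<lambda>y. vector [a (y $ 1), b (y $ 1)] :: real ^ 2) (at x) v
      = vector [a' * v $ 1, b' * v $ 1]" for v
    using frechet_derivative_at[OF vector_2_has_derivative[OF
        radial_has_derivative[OF assms(4)] radial_has_derivative[OF assms(5)]], symmetric] by (rule fun_cong)
  then show ?thesis
    unfolding pullback_cov_def G push_rot_map[OF assms(1)]
    by (simp add: vec_eq_iff forall_2 algebra_simps)
qed

text \<open>
  The radial component of the tension field; its angular component vanishes.
\<close>

definition rot_tension :: "(real \<Rightarrow> real) \<Rightarrow> (real \<Rightarrow> real) \<Rightarrow> (real \<Rightarrow> real) \<Rightarrow> real \<Rightarrow> real \<Rightarrow> real" where
  "rot_tension s l \<rho> k r = deriv (deriv \<rho>) r + deriv s r / s r * deriv \<rho> r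
     - k\<^sup>2 * l (\<rho> r) * deriv l (\<rho> r) / (s r)\<^sup>2"

lemma open_coord_rect: "open I \<Longrightarrow> open J \<Longrightarrow> open (coord_rect I J)"
  unfolding coord_rect_def
  by (intro open_Collect_conj)
    (auto intro!: open_vimage[of _ "\<lambda>x. x $ _", unfolded vimage_def] continuous_intros)

lemma tension_rot_map:
  assumes "open I" "open J" "x \<in> coord_rect I J"
    and "smooth_on I s" "smooth_on I \<rho>" "smooth_on P l"
    and "s (x $ 1) \<noteq> 0" "\<rho> (x $ 1) \<in> P" "l (\<rho> (x $ 1)) \<noteq> 0"
  shows "tension (polar_metric s) (polar_metric l) (rot_map \<rho> k) x
    = vector [rot_tension s l \<rho> k (x $ 1), 0]"
proof -
  let ?h = "polar_metric l" and ?\<phi> = "rot_map \<rho> k" and ?r = "x $ 1"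
  have r: "?r \<in> I" using assms(3) by (simp add: coord_rect_def)
  note d\<rho> = smooth_on_has_real_derivative[OF assms(5)]
  note dd\<rho> = smooth_on_has_real_derivative[OF smooth_on_deriv[OF assms(1,5)] r]
  note dl = smooth_on_has_real_derivative[OF assms(6,8)]
  note ds = smooth_on_has_real_derivative[OF assms(4) r]
  have c1: "pullback_cov ?h ?\<phi> (frame i) (push ?\<phi> (frame 1)) x
      = pullback_cov ?h ?\<phi> (frame i) (\<lambda>y. vector [deriv \<rho> (y $ 1), 0]) x" for i
    by (rule pullback_cov_cong[OF open_coord_rect[OF assms(1,2)] assms(3)])
      (auto simp: push_rot_map[OF d\<rho>] coord_rect_def frame_def axis_def)
  have c2: "pullback_cov ?h ?\<phi> (frame i) (push ?\<phi> (frame 2)) x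
      = pullback_cov ?h ?\<phi> (frame i) (\<lambda>y. vector [0, k]) x" for i
    by (rule pullback_cov_cong[OF open_coord_rect[OF assms(1,2)] assms(3)])
      (auto simp: push_rot_map[OF d\<rho>] coord_rect_def frame_def axis_def)
  have G: "cov_deriv (polar_metric s) (frame i) (frame j) x
      = christoffel_form (polar_metric s) x (axis i 1) (axis j 1)" for i j
    by (simp add: cov_deriv_frame christoffel_form_axis)
  show ?thesis
    unfolding tension_def metric_trace_polar_metric[of s x, OF assms(7)] second_fundamental_form_def c1 c2
      pullback_cov_rot_map[OF d\<rho>[OF r] dl assms(9) dd\<rho> DERIV_const]
      pullback_cov_rot_map[OF d\<rho>[OF r] dl assms(9) DERIV_const DERIV_const]
      push_rot_map[OF d\<rho>[OF r]] G christoffel_form_polar_metric[OF ds assms(7)]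
    using assms(7)
    by (simp add: vec_eq_iff forall_2 frame_def axis_def rot_tension_def field_simps power2_eq_square)
qed

lemma partial_radial:
  fixes x :: "real ^ 2"
  assumes "(q has_real_derivative q') (at (x $ 1))"
  shows "partial i (\<lambda>y. q (y $ 1)) x = (if i = 1 then q' else 0)"
  unfolding partial_def frechet_derivative_at[OF radial_has_derivative[OF assms], symmetric]
  by (simp add: axis_def)

lemma differentiable_cong_open:
  assumes "open U" "x \<in> U" "\<And>y. y \<in> U \<Longrightarrow> F y = G y" "G differentiable (at x)"
  shows "F differentiable (at x)"
  using assms has_derivative_transform_within_open[of G _ x UNIV U F]
  unfolding differentiable_def by metis

lemma differentiable_radial_field:
  fixes x :: "real ^ 'n::finite"
  assumes "(a has_real_derivative a') (at (x $ i))" "(b has_real_derivative b') (at (x $ i))"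
  shows "(\<lambda>y. vector [a (y $ i), b (y $ i)] :: real ^ 2) differentiable (at x)"
  using vector_2_has_derivative[OF radial_has_derivative[OF assms(1)] radial_has_derivative[OF assms(2)]]
  by (rule differentiableI)

lemma differentiable_christoffel_form_polar_metric:
  assumes "open P" "open Q" "smooth_on P l" "\<And>p. p \<in> P \<Longrightarrow> l p \<noteq> 0" "y \<in> coord_rect P Q"
  shows "(\<lambda>z. christoffel_form (polar_metric l) z a b) differentiable (at y)"
proof (rule differentiable_cong_open[OF open_coord_rect[OF assms(1,2)] assms(5)])
  note d = smooth_on_has_real_derivative[OF assms(3)]
    smooth_on_has_real_derivative[OF smooth_on_deriv[OF assms(1,3)]]
  show "christoffel_form (polar_metric l) z a b
      = vector [- l (z $ 1) * deriv l (z $ 1) * a $ 2 * b $ 2,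
          deriv l (z $ 1) / l (z $ 1) * (a $ 1 * b $ 2 + a $ 2 * b $ 1)]"
    if "z \<in> coord_rect P Q" for z
    using that assms(4) d(1) by (intro christoffel_form_polar_metric) (auto simp: coord_rect_def)
  have "y $ 1 \<in> P" using assms(5) by (simp add: coord_rect_def)
  note d = d[OF this] assms(4)[OF this]
  show "(\<lambda>z. vector [- l (z $ 1) * deriv l (z $ 1) * a $ 2 * b $ 2,
      deriv l (z $ 1) / l (z $ 1) * (a $ 1 * b $ 2 + a $ 2 * b $ 1)] :: real ^ 2) differentiable (at y)"
    by (rule differentiable_radial_field[OF
          DERIV_cmult_right[OF DERIV_cmult_right[OF DERIV_mult[OF DERIV_minus[OF d(1)] d(2)]]]
          DERIV_cmult_right[OF DERIV_divide[OF d(2,1,3)]]])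
qed

text \<open>
  The product rule for a radial factor \<open>u\<close> and a radial field \<open>V = T \<partial>\<^sub>\<rho>\<close>: the Laplacian of \<open>u\<close> is
  \<open>u'' + (s'/s) u'\<close>, and \<open>\<nabla>V(grad u) = u' T' \<partial>\<^sub>\<rho>\<close> because the \<open>\<rho>\<close>-lines are geodesics. The angular
  derivative of \<open>V\<close> need not vanish, but it does not meet the gradient of \<open>u\<close>.
\<close>

lemma jacobi_operator_radial_multiple:
  assumes "open I" "open J" "x \<in> coord_rect I J" "open P" "open Q" "rot_map \<rho> k x \<in> coord_rect P Q"
    and s: "smooth_on I s" "\<And>r. r \<in> I \<Longrightarrow> s r \<noteq> 0"
    and l: "smooth_on P l" "\<And>p. p \<in> P \<Longrightarrow> l p \<noteq> 0"
    and "smooth_on I \<rho>" "\<And>r. r \<in> I \<Longrightarrow> \<rho> r \<in> P" "smooth_on I u" "smooth_on I T"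
  shows "jacobi_operator (polar_metric s) (polar_metric l) (rot_map \<rho> k)
      (\<lambda>y. u (y $ 1) *\<^sub>R vector [T (y $ 1), 0]) x
    = u (x $ 1) *\<^sub>R jacobi_operator (polar_metric s) (polar_metric l) (rot_map \<rho> k)
        (\<lambda>y. vector [T (y $ 1), 0]) x
      + vector [(deriv (deriv u) (x $ 1) + deriv s (x $ 1) / s (x $ 1) * deriv u (x $ 1)) * T (x $ 1)
          + 2 * deriv u (x $ 1) * deriv T (x $ 1), 0]"
proof -
  let ?U = "coord_rect I J" and ?r = "x $ 1"
  let ?g = "polar_metric s" and ?h = "polar_metric l" and ?\<phi> = "rot_map \<rho> k"
  let ?u = "\<lambda>y :: real ^ 2. u (y $ 1)" and ?V = "\<lambda>y :: real ^ 2. vector [T (y $ 1), 0] :: real ^ 2"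
  have U: "open ?U" using assms(1,2) by (rule open_coord_rect)
  have I: "y $ 1 \<in> I" if "y \<in> ?U" for y using that by (simp add: coord_rect_def)
  note r = I[OF assms(3)]
  note d\<rho> = smooth_on_has_real_derivative[OF assms(11)]
  note dd\<rho> = smooth_on_has_real_derivative[OF smooth_on_deriv[OF assms(1,11)]]
  note dl = smooth_on_has_real_derivative[OF l(1)]
  note ddl = smooth_on_has_real_derivative[OF smooth_on_deriv[OF assms(4) l(1)]]
  note ds = smooth_on_has_real_derivative[OF s(1)]
  note du = smooth_on_has_real_derivative[OF assms(13)]
  note ddu = smooth_on_has_real_derivative[OF smooth_on_deriv[OF assms(1,13)]]
  note dT = smooth_on_has_real_derivative[OF assms(14)]
  note ddT = smooth_on_has_real_derivative[OF smooth_on_deriv[OF assms(1,14)]]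
  have pu: "partial j ?u y = (if j = 1 then deriv u (y $ 1) else 0)" if "y \<in> ?U" for j y
    by (rule partial_radial[OF du[OF I[OF that]]])
  have ddu': "(\<lambda>y. if j = 1 then deriv u (y $ 1) else 0) differentiable (at x)" for j :: 2
    using radial_has_derivative[OF ddu[OF r]] by (cases "j = 1") (auto intro: differentiableI)
  have ppu: "partial i (partial j ?u) x = (if i = 1 \<and> j = 1 then deriv (deriv u) ?r else 0)" for i j
  proof -
    have "partial i (partial j ?u) x = partial i (\<lambda>y. if j = 1 then deriv u (y $ 1) else 0) x"
      unfolding partial_def[of i] using frechet_derivative_cong_open[OF U assms(3) pu] by simp
    then show ?thesis
      using partial_radial[OF ddu[OF r], of i]
      by (cases "j = 1") (simp_all add: partial_def frechet_derivative_const)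
  qed
  have D: "pullback_cov ?h ?\<phi> (frame j) ?V y = vector [if j = 1 then deriv T (y $ 1) else 0,
      if j = 1 then 0 else deriv l (\<rho> (y $ 1)) / l (\<rho> (y $ 1)) * k * T (y $ 1)]" if "y \<in> ?U" for j y
    using pullback_cov_rot_map[OF d\<rho> dl l(2) dT DERIV_const, of y k "frame j" 0] I[OF that] assms(12)
      exhaust_2[of j] by (auto simp: frame_def axis_def mult_ac)
  have dD: "pullback_cov ?h ?\<phi> (frame j) ?V differentiable (at x)" for j
  proof (rule differentiable_cong_open[OF U assms(3) D])
    have "((\<lambda>r. deriv l (\<rho> r)) has_real_derivative deriv (deriv l) (\<rho> ?r) * deriv \<rho> ?r) (at ?r)"
      "((\<lambda>r. l (\<rho> r)) has_real_derivative deriv l (\<rho> ?r) * deriv \<rho> ?r) (at ?r)"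
      using DERIV_chain2[OF ddl d\<rho>] DERIV_chain2[OF dl d\<rho>] r assms(12) by auto
    note q = DERIV_mult[OF DERIV_cmult_right[OF DERIV_divide[OF this l(2)[OF assms(12)[OF r]]]] dT[OF r], of k]
    show "(\<lambda>y. vector [if j = 1 then deriv T (y $ 1) else 0, if j = 1 then 0 else
        deriv l (\<rho> (y $ 1)) / l (\<rho> (y $ 1)) * k * T (y $ 1)] :: real ^ 2) differentiable (at x)"
      using differentiable_radial_field[OF ddT[OF r] DERIV_const, of 0]
        differentiable_radial_field[OF DERIV_const q, of 0]
      by (cases "j = 1") simp_all
  qed
  have "jacobi_operator ?g ?h ?\<phi> (\<lambda>y. ?u y *\<^sub>R ?V y) x
    = ?u x *\<^sub>R jacobi_operator ?g ?h ?\<phi> ?V x + laplace_beltrami ?g ?u x *\<^sub>R ?V x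
      + metric_trace ?g x (\<lambda>i j. partial i ?u x *\<^sub>R pullback_cov ?h ?\<phi> (frame j) ?V x
          + partial j ?u x *\<^sub>R pullback_cov ?h ?\<phi> (frame i) ?V x)"
  proof (rule jacobi_operator_scaleR[OF U assms(3) _ _ _ dD])
    show "?u differentiable (at y)" if "y \<in> ?U" for y
      using radial_has_derivative[OF du[OF I[OF that]]] by (rule differentiableI)
    show "partial j ?u differentiable (at x)" for j
      by (rule differentiable_cong_open[OF U assms(3) pu ddu'])
    show "?V differentiable (at y)" if "y \<in> ?U" for y
      by (rule differentiable_radial_field[OF dT[OF I[OF that]] DERIV_const])
    show "(\<lambda>z. christoffel_form ?h z a b) differentiable (at (?\<phi> x))" for a b
      using assms(4-6) l by (intro differentiable_christoffel_form_polar_metric) auto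
  qed
  moreover have "laplace_beltrami ?g ?u x = deriv (deriv u) ?r + deriv s ?r / s ?r * deriv u ?r"
    unfolding laplace_beltrami_def ppu cov_deriv_frame christoffel_form_axis[symmetric]
      christoffel_form_polar_metric[of s _ x, OF ds[OF r] s(2)[OF r]]
      frechet_derivative_at[OF radial_has_derivative[OF du[OF r]], symmetric]
    using s(2)[OF r]
    by (simp add: sum_2 matrix_inv_polar_metric[of s x, OF s(2)[OF r]] axis_def power2_eq_square)
  ultimately show ?thesis
    unfolding metric_trace_polar_metric[of s x, OF s(2)[OF r]] D[OF assms(3)] pu[OF assms(3)]
    by (simp add: vec_eq_iff forall_2)
qed

section \<open>Radial conformal changes preserving biharmonicity\<close>

lemma smooth_on_rot_tension:
  assumes "open I" "smooth_on I s" "\<And>r. r \<in> I \<Longrightarrow> s r \<noteq> 0" "smooth_on I \<rho>"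
    and "open P" "smooth_on P l" "\<rho> ` I \<subseteq> P"
  shows "smooth_on I (rot_tension s l \<rho> k)"
proof (rule smooth_on_cong[OF assms(1)])
  note c = smooth_on_compose[OF assms(1,7,4)]
  show "smooth_on I (\<lambda>r. deriv (deriv \<rho>) r + deriv s r * inverse (s r) * deriv \<rho> r
      + (- k\<^sup>2) * l (\<rho> r) * deriv l (\<rho> r) * inverse (s r * s r))"
    using assms
    by (intro smooth_on_add smooth_on_mult smooth_on_inverse smooth_on_deriv smooth_on_const
        c[of l] c[of "deriv l"]) auto
qed (simp add: rot_tension_def power2_eq_square divide_inverse)

theorem theorem2p6:
  fixes I J P Q :: "real set"
    and \<sigma> lam \<rho> F f :: "real \<Rightarrow> real"
    and k C1 C2 :: real
  assumes "open I" "is_interval I" "open J" "is_interval J"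
    and "open P" "is_interval P" "open Q" "is_interval Q"
    and "smooth_on I \<sigma>" "\<forall>r\<in>I. \<sigma> r > 0"
    and "smooth_on P lam" "\<forall>s\<in>P. lam s > 0"
    and "smooth_on I \<rho>"
    and "proper_biharmonic_map (coord_rect I J) (polar_metric \<sigma>)
           (coord_rect P Q) (polar_metric lam) (rot_map \<rho> k)"
    and "\<forall>x\<in>coord_rect I J. tension (polar_metric \<sigma>) (polar_metric lam) (rot_map \<rho> k) x \<noteq> 0"
    and "C1\<^sup>2 + C2\<^sup>2 \<noteq> 0"
    and "\<forall>r\<in>I. (F has_real_derivative
           (deriv (deriv \<rho>) r + deriv \<sigma> r / \<sigma> r * deriv \<rho> r
             - k\<^sup>2 * lam (\<rho> r) * deriv lam (\<rho> r) / (\<sigma> r)\<^sup>2) powi (-2)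
           * (\<sigma> r) powi (-1)) (at r)"
    and "\<forall>r\<in>I. f r = C1 + C2 * F r"
    and "\<forall>r\<in>I. f r > 0"
  shows "proper_biharmonic_map (coord_rect I J)
           (\<lambda>x. (1 / f (x $ 1)) *\<^sub>R polar_metric \<sigma> x)
           (coord_rect P Q) (polar_metric lam) (rot_map \<rho> k)"
proof -
  let ?U = "coord_rect I J" and ?g = "polar_metric \<sigma>" and ?h = "polar_metric lam"
    and ?\<phi> = "rot_map \<rho> k"
  let ?c = "\<lambda>x :: real ^ 2. 1 / f (x $ 1)"
  let ?g' = "\<lambda>x. ?c x *\<^sub>R ?g x"
  define T where "T = rot_tension \<sigma> lam \<rho> k"
  note \<sigma>_pos = assms(10)[rule_format] and lam_pos = assms(12)[rule_format] and f_pos = assms(19)[rule_format]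
  have map: "smooth_riemannian_map ?U ?g (coord_rect P Q) ?h ?\<phi>"
    and bih: "\<And>x. x \<in> ?U \<Longrightarrow> bitension ?g ?h ?\<phi> x = 0"
    and "\<not> harmonic_map ?U ?g (coord_rect P Q) ?h ?\<phi>"
    using assms(14) by (auto simp: proper_biharmonic_map_def biharmonic_map_def)
  then obtain x0 where x0: "x0 \<in> ?U" by (auto simp: harmonic_map_def)
  have metric: "smooth_on ?U ?g" "\<And>x. x \<in> ?U \<Longrightarrow> transpose (?g x) = ?g x"
    "\<And>x v. x \<in> ?U \<Longrightarrow> v \<noteq> 0 \<Longrightarrow> v \<bullet> (?g x *v v) > 0"
    and U: "open ?U" and \<phi>: "smooth_on ?U ?\<phi>" "\<And>x. x \<in> ?U \<Longrightarrow> ?\<phi> x \<in> coord_rect P Q"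
    using map by (auto simp: smooth_riemannian_map_def riemannian_metric_on_def)
  have I: "x $ 1 \<in> I" if "x \<in> ?U" for x using that by (simp add: coord_rect_def)
  \<comment> \<open>Every radius occurs at the angle of \<open>x0\<close>, so that facts on the rectangle descend to \<open>I\<close>.\<close>
  have \<rho>_P: "\<rho> r \<in> P" if "r \<in> I" for r
    using \<phi>(2)[of "vector [r, x0 $ 2]"] x0 that by (auto simp: coord_rect_def rot_map_def)
  have tension: "tension ?g ?h ?\<phi> x = vector [T (x $ 1), 0]" if "x \<in> ?U" for x
    unfolding T_def using that assms(1,3,9,11,13) I[OF that] \<rho>_P \<sigma>_pos lam_pos
    by (intro tension_rot_map) (auto simp: less_imp_neq[symmetric])
  have T_nz: "T r \<noteq> 0" if "r \<in> I" for r
  proof -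
    have "(vector [r, x0 $ 2] :: real ^ 2) \<in> ?U" using that x0 by (simp add: coord_rect_def)
    with assms(15) tension have "(vector [T r, 0] :: real ^ 2) \<noteq> 0" by fastforce
    then show ?thesis by (simp add: vec_eq_iff forall_2)
  qed
  have T_smooth: "smooth_on I T"
    unfolding T_def using assms(1,5,9,11,13) \<rho>_P \<sigma>_pos
    by (intro smooth_on_rot_tension) (auto simp: less_imp_neq[symmetric])
  have f_der: "(f has_real_derivative C2 * (inverse (T r * T r) * inverse (\<sigma> r))) (at r)" if "r \<in> I" for r
  proof (rule has_field_derivative_transform_within_open[OF _ assms(1) that])
    show "((\<lambda>r. C1 + C2 * F r) has_real_derivative C2 * (inverse (T r * T r) * inverse (\<sigma> r))) (at r)"
      using assms(17)[rule_format, OF that]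
      by (auto intro!: derivative_eq_intros
          simp: T_def rot_tension_def power_int_minus power2_eq_square)
  qed (use assms(18) in simp)
  have f_smooth: "smooth_on I f"
    by (rule smooth_on_antiderivative[OF assms(1) _ f_der])
      (use assms(1,9) T_smooth T_nz \<sigma>_pos in \<open>auto intro!: smooth_on_mult smooth_on_const smooth_on_inverse
        simp: less_imp_neq[symmetric]\<close>)
  \<comment> \<open>The choice of \<open>f\<close> makes its derivative times \<open>T\<^sup>2 \<sigma>\<close> the constant \<open>C2\<close>; differentiating this and dividing
    by \<open>T \<sigma>\<close> gives the vanishing of the terms of \<open>J(f \<tau>)\<close> that contain derivatives of \<open>f\<close>.\<close>
  have ode: "(deriv (deriv f) r + deriv \<sigma> r / \<sigma> r * deriv f r) * T r + 2 * deriv f r * deriv T r = 0"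
    if "r \<in> I" for r
  proof -
    have "deriv f q * (T q * T q * \<sigma> q) = C2" if "q \<in> I" for q
      using DERIV_imp_deriv[OF f_der[OF that]] T_nz[OF that] \<sigma>_pos[OF that]
      by (simp add: field_simps)
    then have "((\<lambda>q. deriv f q * (T q * T q * \<sigma> q)) has_real_derivative 0) (at r)"
      by (intro has_field_derivative_transform_within_open[OF DERIV_const[of C2] assms(1) that]) simp
    moreover have "((\<lambda>q. deriv f q * (T q * T q * \<sigma> q)) has_real_derivative
        deriv (deriv f) r * (T r * T r * \<sigma> r)
        + deriv f r * (2 * T r * deriv T r * \<sigma> r + T r * T r * deriv \<sigma> r)) (at r)"
      using smooth_on_has_real_derivative[OF T_smooth that] smooth_on_has_real_derivative[OF assms(9) that]
        smooth_on_has_real_derivative[OF smooth_on_deriv[OF assms(1) f_smooth] that]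
      by (auto intro!: derivative_eq_intros simp: algebra_simps)
    ultimately have "0 = deriv (deriv f) r * (T r * T r * \<sigma> r)
        + deriv f r * (2 * T r * deriv T r * \<sigma> r + T r * T r * deriv \<sigma> r)"
      by (rule DERIV_unique)
    also have "\<dots> = T r * \<sigma> r * ((deriv (deriv f) r + deriv \<sigma> r / \<sigma> r * deriv f r) * T r
        + 2 * deriv f r * deriv T r)"
      using \<sigma>_pos[OF that] by (simp add: field_simps)
    finally show ?thesis using T_nz[OF that] \<sigma>_pos[OF that] by simp
  qed
  have c_smooth: "smooth_on ?U ?c"
    using smooth_on_inverse[OF U _ smooth_on_compose[OF U _ smooth_on_bounded_linear[OF bounded_linear_vec_nth] f_smooth]]
      I f_pos by (force simp: inverse_eq_divide less_imp_neq[symmetric])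
  have conformal: "CARD(2) = 2" "transpose (?g x) = ?g x" "invertible (?g x)" "?c x \<noteq> 0"
    "?g differentiable (at x)" "?c differentiable (at x)" "?\<phi> differentiable (at x)" if "x \<in> ?U" for x
    using metric that f_pos[OF I[OF that]] positive_definite_invertible[of "?g x"]
      smooth_on_differentiable[OF _ that] c_smooth \<phi>(1) by auto
  have tension': "tension ?g' ?h ?\<phi> x = f (x $ 1) *\<^sub>R vector [T (x $ 1), 0]" if "x \<in> ?U" for x
    using tension_conformal[where g = ?g and c = ?c, OF conformal[OF that]] tension[OF that] by simp
  have "bitension ?g' ?h ?\<phi> x = 0" if x: "x \<in> ?U" for x
  proof -
    note df = smooth_on_has_real_derivative[OF f_smooth I[OF x]]
      and dT = smooth_on_has_real_derivative[OF T_smooth I[OF x]]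
    have V: "(\<lambda>y. f (y $ 1) *\<^sub>R vector [T (y $ 1), 0] :: real ^ 2) differentiable (at x)"
      using differentiableI[OF radial_has_derivative[OF df]]
        differentiable_radial_field[OF dT DERIV_const] by (rule differentiable_scaleR_fun)
    have "jacobi_operator ?g ?h ?\<phi> (\<lambda>y. vector [T (y $ 1), 0]) x = 0"
      using bih[OF x] jacobi_operator_cong[OF U x tension]
      by (simp add: bitension_eq_jacobi_operator)
    then have "jacobi_operator ?g ?h ?\<phi> (\<lambda>y. f (y $ 1) *\<^sub>R vector [T (y $ 1), 0]) x = 0"
      using jacobi_operator_radial_multiple[OF assms(1,3) x assms(5,7) \<phi>(2)[OF x] assms(9) _ assms(11) _
          assms(13) \<rho>_P f_smooth T_smooth] \<sigma>_pos lam_pos ode[OF I[OF x]]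
      by (force simp: vec_eq_iff forall_2)
    moreover have "bitension ?g' ?h ?\<phi> x
        = jacobi_operator ?g' ?h ?\<phi> (\<lambda>y. f (y $ 1) *\<^sub>R vector [T (y $ 1), 0]) x"
      unfolding bitension_eq_jacobi_operator by (rule jacobi_operator_cong[OF U x tension'])
    moreover have "\<dots> = (1 / ?c x) *\<^sub>R
        jacobi_operator ?g ?h ?\<phi> (\<lambda>y. f (y $ 1) *\<^sub>R vector [T (y $ 1), 0]) x"
      by (rule jacobi_operator_conformal[OF conformal[OF x] V])
    ultimately show ?thesis by simp
  qed
  moreover have "smooth_riemannian_map ?U ?g' (coord_rect P Q) ?h ?\<phi>"
  proof -
    have "riemannian_metric_on ?U ?g'"
      using smooth_on_scaleR[OF U c_smooth metric(1)] metric(2,3) f_pos[OF I]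
      by (auto simp: riemannian_metric_on_def transpose_scalar scaleR_matrix_vector_assoc[symmetric])
    then show ?thesis using map by (simp add: smooth_riemannian_map_def)
  qed
  moreover have "tension ?g' ?h ?\<phi> x0 \<noteq> 0"
    using tension'[OF x0] T_nz[OF I[OF x0]] f_pos[OF I[OF x0]] by (simp add: vec_eq_iff forall_2)
  ultimately show ?thesis
    using x0 by (auto simp: proper_biharmonic_map_def biharmonic_map_def harmonic_map_def)
qed

end
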